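(* Let $0\le k\le n$ be integers. If $q\ge 2$ is an integer, then the $(q,t)$-binomial coefficient $\left[\begin{smallmatrix} n\\k\end{smallmatrix}\right]_{q,t}$ is a polynomial in $t$ with nonnegative (integer) coefficients.
   Context: For integers $n\ge 0$ put $n!_{q,t}:=\prod_{i=0}^{n-1}(1-t^{q^n-q^i})$. For $0\le k\le n$ the $(q,t)$-binomial coefficient is $$\left[\begin{matrix} n\\k\end{matrix}\right]_{q,t}:=\frac{n!_{q,t}}{k!_{q,t}\cdot (n-k)!_{q,t^{q^k}}}=\prod_{i=1}^{k}\frac{1-t^{q^n-q^{i-1}}}{1-t^{q^k-q^{i-1}}},$$ where $(n-k)!_{q,t^{q^k}}$ means $(n-k)!_{q,t}$ with $t$ replaced by $t^{q^k}$. Here, for a fixed integer $q\ge2$, it is viewed as a rational function of the single variable $t$. *)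

theory Defs
  imports "HOL-Computational_Algebra.Polynomial_Factorial"
begin

text \<open>The parameter \<open>t\<close> is an argument, because the definition of the \<open>(q,t)\<close>-binomial
  coefficient evaluates one of the factorials at a power of \<open>t\<close>. The truncated subtraction
  in the exponent is exact, since \<open>q ^ i \<le> q ^ n\<close> for \<open>i < n\<close> and \<open>q \<ge> 1\<close>.\<close>

definition qt_fact :: "nat \<Rightarrow> 'a::comm_ring_1 \<Rightarrow> nat \<Rightarrow> 'a" where
  "qt_fact q t n = (\<Prod>i<n. 1 - t ^ (q ^ n - q ^ i))"

definition qt_binomial :: "nat \<Rightarrow> 'a::field \<Rightarrow> nat \<Rightarrow> nat \<Rightarrow> 'a" where
  "qt_binomial q t n k = qt_fact q t n / (qt_fact q t k * qt_fact q (t ^ (q ^ k)) (n - k))"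

text \<open>The indeterminate of the field of rational functions, as the fraction field of
  \<open>\<int>[t]\<close> (which is \<open>\<rat>(t)\<close>).\<close>

definition ratfun_var :: "int poly fract" where
  "ratfun_var = to_fract [:0, 1:]"

text \<open>For \<open>q \<ge> 2\<close> no denominator vanishes at the indeterminate or at its positive powers,
  so the division above is a genuine one.\<close>

lemma ratfun_var_power_neq_1: "m > 0 \<Longrightarrow> ratfun_var ^ m \<noteq> 1"
proof
  assume m: "m > 0" and eq: "ratfun_var ^ m = 1"
  have pow: "to_fract p ^ j = to_fract (p ^ j)" for p :: "int poly" and j
    by (induction j) simp_all
  have "to_fract ([:0, 1:] ^ m) = to_fract (1 :: int poly)"
    using eq by (simp add: ratfun_var_def pow)
  hence "[:0, 1:] ^ m = (1 :: int poly)"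
    by (simp only: to_fract_eq_iff)
  hence "degree ([:0, 1:] ^ m :: int poly) = degree (1 :: int poly)" by (rule arg_cong)
  with m show False by (simp add: degree_power_eq)
qed

lemma qt_fact_ratfun_var_nonzero:
  assumes "q \<ge> 2" "m > 0"
  shows "qt_fact q (ratfun_var ^ m) n \<noteq> 0"
  unfolding qt_fact_def
proof (subst prod_zero_iff, simp, safe)
  fix i assume "i < n" "1 - (ratfun_var ^ m) ^ (q ^ n - q ^ i) = 0"
  moreover have "m * (q ^ n - q ^ i) > 0"
    using assms \<open>i < n\<close> by (simp add: power_strict_increasing)
  ultimately show False
    using ratfun_var_power_neq_1 by (simp flip: power_mult)
qed

text \<open>The product form of the \<open>(q,t)\<close>-binomial coefficient.\<close>

lemma qt_binomial_altdef:
  assumes q: "q \<ge> 2" and kn: "k \<le> n"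
  shows "qt_binomial q ratfun_var n k =
    (\<Prod>i=1..k. (1 - ratfun_var ^ (q ^ n - q ^ (i - 1))) / (1 - ratfun_var ^ (q ^ k - q ^ (i - 1))))"
proof -
  let ?f = "\<lambda>i. 1 - ratfun_var ^ (q ^ n - q ^ i)"
  have "qt_fact q ratfun_var n = prod ?f {..<k} * prod ?f {k..<n}"
    unfolding qt_fact_def lessThan_atLeast0
    by (rule prod.atLeastLessThan_concat [symmetric]) (use kn in auto)
  also have "prod ?f {k..<n} = (\<Prod>j<n - k. ?f (k + j))"
    using prod.shift_bounds_nat_ivl [of ?f 0 k "n - k"] kn by (simp add: lessThan_atLeast0 add.commute)
  also have "\<dots> = qt_fact q (ratfun_var ^ (q ^ k)) (n - k)"
    unfolding qt_fact_def
  proof (intro prod.cong refl)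
    fix j
    have "q ^ n - q ^ (k + j) = q ^ k * (q ^ (n - k) - q ^ j)"
      using kn by (simp add: diff_mult_distrib2 flip: power_add)
    thus "?f (k + j) = 1 - (ratfun_var ^ (q ^ k)) ^ (q ^ (n - k) - q ^ j)"
      by (simp add: power_mult)
  qed
  finally have "qt_fact q ratfun_var n =
    prod ?f {..<k} * qt_fact q (ratfun_var ^ (q ^ k)) (n - k)" .
  moreover have "qt_fact q (ratfun_var ^ (q ^ k)) (n - k) \<noteq> 0"
    using q by (intro qt_fact_ratfun_var_nonzero) auto
  ultimately have "qt_binomial q ratfun_var n k = prod ?f {..<k} / qt_fact q ratfun_var k"
    by (simp add: qt_binomial_def)
  also have "\<dots> = (\<Prod>i<k. ?f i / (1 - ratfun_var ^ (q ^ k - q ^ i)))"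
    by (simp add: qt_fact_def prod_dividef)
  also have "\<dots> = (\<Prod>i=1..k. ?f (i - 1) / (1 - ratfun_var ^ (q ^ k - q ^ (i - 1))))"
    by (rule prod.reindex_bij_witness [of _ "\<lambda>i. i - 1" Suc]) auto
  finally show ?thesis .
qed

end

theory Submission
  imports Defs
begin

text \<open>Cancelling common factors gives \<open>[n, k]\<^sub>t = N(n, k, t) / N(k, k, t)\<close> with
  \<open>N(n, k, t) = (\<Prod>i<k. 1 - t ^ (q ^ n - q ^ i))\<close> (\<open>qt_num\<close>). The positivity comes from the Pascal rule

    \<open>[n, k]\<^sub>t = [n - 1, k - 1]\<^sub>u + t ^ (q ^ k - 1) * (N(k, k, u) / N(k, k, t)) * [n - 1, k]\<^sub>u\<close>
    where \<open>u = t ^ q\<close>,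

  because the middle quotient is visibly positive: its factors are
  \<open>(1 - x ^ q) / (1 - x) = 1 + x + \<dots> + x ^ (q - 1)\<close> with \<open>x\<close> a power of \<open>t\<close>.
  Induction on \<open>n\<close>, with \<open>t\<close> arbitrary so that it may be replaced by \<open>t ^ q\<close>, then writes the
  coefficient with additions and multiplications only, starting from \<open>t\<close>.

  Cleared of denominators, this argument is valid in every commutative ring, for every
  subsemiring containing \<open>t\<close> (\<open>qt_num_multiple_in_semiring\<close>). The theorem is the instance of the
  polynomials with nonnegative coefficients inside the field of rational functions.\<close>

definition qt_num :: "nat \<Rightarrow> 'a::comm_ring_1 \<Rightarrow> nat \<Rightarrow> nat \<Rightarrow> 'a" where
  "qt_num q t n k = (\<Prod>i<k. 1 - t ^ (q ^ n - q ^ i))"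

lemma qt_num_0 [simp]: "qt_num q t n 0 = 1"
  by (simp add: qt_num_def)

lemma qt_num_Suc_Suc:
  "qt_num q t (Suc n) (Suc k) = (1 - t ^ (q ^ Suc n - 1)) * qt_num q (t ^ q) n k"
  by (simp add: qt_num_def prod.lessThan_Suc_shift diff_mult_distrib2 flip: power_mult
      del: prod.lessThan_Suc)

text \<open>All three products contain \<open>N(n, k, t ^ q)\<close>; up to this factor, the rule is
  \<open>1 - a b = (1 - a) + a (1 - b)\<close> for \<open>a = t ^ (q ^ Suc k - 1)\<close> and
  \<open>b = t ^ (q ^ Suc n - q ^ Suc k)\<close>.\<close>

lemma qt_num_pascal:
  assumes "q > 0" "k \<le> n"
  shows "qt_num q t (Suc n) (Suc k) =
    (1 - t ^ (q ^ Suc k - 1)) * qt_num q (t ^ q) n k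
      + t ^ (q ^ Suc k - 1) * qt_num q (t ^ q) n (Suc k)"
proof -
  have "1 \<le> q ^ Suc k" "q ^ Suc k \<le> q ^ Suc n"
    using assms by (simp_all add: power_increasing del: power_Suc)
  hence "q ^ Suc n - 1 = (q ^ Suc k - 1) + (q ^ Suc n - q ^ Suc k)"
    by linarith
  hence ab: "t ^ (q ^ Suc n - 1) = t ^ (q ^ Suc k - 1) * t ^ (q ^ Suc n - q ^ Suc k)"
    by (simp only: power_add)
  have "qt_num q (t ^ q) n (Suc k) = qt_num q (t ^ q) n k * (1 - t ^ (q ^ Suc n - q ^ Suc k))"
    by (simp add: qt_num_def diff_mult_distrib2 flip: power_mult)
  thus ?thesis
    unfolding qt_num_Suc_Suc ab by (simp only:) (simp add: algebra_simps)
qed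

lemma qt_num_power:
  "qt_num q (t ^ m) n k = (\<Prod>i<k. \<Sum>j<m. (t ^ (q ^ n - q ^ i)) ^ j) * qt_num q t n k"
proof -
  have "1 - (t ^ m) ^ e = (\<Sum>j<m. (t ^ e) ^ j) * (1 - t ^ e)" for e
    using one_diff_power_eq [of "t ^ e" m] by (simp add: mult.commute flip: power_mult)
  thus ?thesis
    by (simp add: qt_num_def prod.distrib)
qed

lemma qt_num_multiple_in_semiring:
  fixes t :: "'a::comm_ring_1"
  assumes S: "0 \<in> S" "1 \<in> S" "\<And>x y. x \<in> S \<Longrightarrow> y \<in> S \<Longrightarrow> x + y \<in> S"
      "\<And>x y. x \<in> S \<Longrightarrow> y \<in> S \<Longrightarrow> x * y \<in> S"
    and q: "q > 0" and "t \<in> S" "k \<le> n"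
  shows "\<exists>c\<in>S. qt_num q t n k = c * qt_num q t k k"
  using \<open>t \<in> S\<close> \<open>k \<le> n\<close>
proof (induction n arbitrary: k t)
  case 0
  thus ?case using S by auto
next
  case (Suc n)
  have pow: "x ^ m \<in> S" if "x \<in> S" for x m
    using that by (induction m) (auto intro: S)
  have sum: "sum f A \<in> S" if "\<And>x. x \<in> A \<Longrightarrow> f x \<in> S" for f :: "nat \<Rightarrow> 'a" and A
    using that by (induction A rule: infinite_finite_induct) (auto intro: S)
  have prod: "prod f A \<in> S" if "\<And>x. x \<in> A \<Longrightarrow> f x \<in> S" for f :: "nat \<Rightarrow> 'a" and A
    using that by (induction A rule: infinite_finite_induct) (auto intro: S)
  show ?case
  proof (cases "k = 0 \<or> k = Suc n")
    case True
    thus ?thesis using S by (intro bexI [of _ 1]) auto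
  next
    case False
    then obtain j where j: "k = Suc j" "Suc j \<le> n"
      using Suc.prems by (cases k) auto
    obtain c where c: "c \<in> S" "qt_num q (t ^ q) n j = c * qt_num q (t ^ q) j j"
      using Suc.IH [of "t ^ q" j] Suc.prems pow j by auto
    obtain d where d: "d \<in> S"
      "qt_num q (t ^ q) n (Suc j) = d * qt_num q (t ^ q) (Suc j) (Suc j)"
      using Suc.IH [of "t ^ q" "Suc j"] Suc.prems pow j by auto
    define g where "g = (\<Prod>i<Suc j. \<Sum>l<q. (t ^ (q ^ Suc j - q ^ i)) ^ l)"
    have g: "g \<in> S"
      unfolding g_def by (intro prod sum pow Suc.prems)
    have "qt_num q t (Suc n) (Suc j) =
        c * qt_num q t (Suc j) (Suc j)
          + t ^ (q ^ Suc j - 1) * (d * (g * qt_num q t (Suc j) (Suc j)))"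
      using qt_num_pascal [of q j n t] q j
      unfolding c(2) d(2) qt_num_power [of q t q "Suc j" "Suc j"] g_def [symmetric]
        qt_num_Suc_Suc [of q t j j]
      by (simp add: mult_ac)
    also have "\<dots> = (c + t ^ (q ^ Suc j - 1) * d * g) * qt_num q t (Suc j) (Suc j)"
      by (simp only: algebra_simps)
    finally show ?thesis
      unfolding j(1) by (intro bexI [of _ "c + t ^ (q ^ Suc j - 1) * d * g"] S c(1) d(1) g pow Suc.prems)
  qed
qed

lemma qt_binomial_eq_qt_num:
  assumes "q \<ge> 2" "k \<le> n"
  shows "qt_binomial q ratfun_var n k = qt_num q ratfun_var n k / qt_num q ratfun_var k k"
proof -
  have "qt_binomial q ratfun_var n k = (\<Prod>i<k.
      (1 - ratfun_var ^ (q ^ n - q ^ i)) / (1 - ratfun_var ^ (q ^ k - q ^ i)))"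
    unfolding qt_binomial_altdef [OF assms]
    by (rule prod.reindex_bij_witness [of _ Suc "\<lambda>i. i - 1"]) auto
  thus ?thesis
    by (simp add: qt_num_def prod_dividef)
qed

theorem corollary4p2:
  fixes q n k :: nat
  assumes "k \<le> n" and "q \<ge> 2"
  shows "\<exists>p :: int poly. qt_binomial q ratfun_var n k = to_fract p \<and> (\<forall>i. coeff p i \<ge> 0)"
proof -
  define S where "S = to_fract ` {p :: int poly. \<forall>i. coeff p i \<ge> 0}"
  have S: "to_fract p \<in> S" if "\<And>i. coeff p i \<ge> 0" for p
    using that by (auto simp: S_def)
  have "0 \<in> S" "1 \<in> S"
    using S [of 0] S [of 1] by simp_all
  moreover have "ratfun_var \<in> S"
    unfolding ratfun_var_def by (rule S) (simp add: coeff_pCons split: nat.split)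
  moreover have "x + y \<in> S" if "x \<in> S" "y \<in> S" for x y
    using that by (auto simp: S_def simp flip: to_fract_add intro!: imageI)
  moreover have "x * y \<in> S" if "x \<in> S" "y \<in> S" for x y
    using that
    by (auto simp: S_def coeff_mult simp flip: to_fract_mult intro!: imageI sum_nonneg)
  ultimately obtain c where c: "c \<in> S"
    "qt_num q ratfun_var n k = c * qt_num q ratfun_var k k"
    using qt_num_multiple_in_semiring [of S q ratfun_var k n] assms by auto
  have "qt_num q ratfun_var k k \<noteq> 0"
    using qt_fact_ratfun_var_nonzero [of q 1 k] assms by (simp add: qt_fact_def qt_num_def)
  hence "qt_binomial q ratfun_var n k = c"
    using c qt_binomial_eq_qt_num assms by simp
  thus ?thesis
    using c by (auto simp: S_def)
qed

end
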